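(* Let $\Omega$ be a nonempty subset of $\mathbb{R}^n$, let $F\in\mathcal{F}^1(\Omega)$ and assume $\kappa:=\Gamma^1(F;\Omega)>0$. Let $U^+$ be the 1-field on $\mathbb{R}^n$ given by $U^+(x)(a)=u^+(x)+\langle D_xu^+,a-x\rangle$ ($x,a\in\mathbb{R}^n$), where $$u^+(x)=\max_{v\in\Lambda_x}\inf_{a\in\Omega}\Psi^+(F,x,a,v),\qquad D_xu^+=\arg\max_{v\in\Lambda_x}\inf_{a\in\Omega}\Psi^+(F,x,a,v).$$ Then $U^+$ is the unique over extremal Lipschitz extension of $F$ on $\mathbb{R}^n$.
   Context: Fix an integer $n\ge 1$; $\mathbb{R}^n$ carries the standard scalar product and Euclidean norm. A 1-field on a nonempty set $\Omega\subset\mathbb{R}^n$ is a map $F$ assigning to each $x\in \Omega$ the polynomial $F(x)(a)=f_x+\langle D_xf,a-x\rangle$ ($a\in\mathbb{R}^n$), where $f_x\in\mathbb{R}$ and $D_xf\in\mathbb{R}^n$ (a 1-field $G$ similarly has associated data $g(x)=g_x$ and $D_xg$). For $x\ne y$ in $\Omega$, $$\Gamma^1(F;x,y)=2\sup_{a\in\mathbb{R}^n}\frac{|F(x)(a)-F(y)(a)|}{\|x-a\|^2+\|y-a\|^2},$$ and $\Gamma^1(F;\Omega)=\sup_{x\ne y\in \Omega}\Gamma^1(F;x,y)$. $\mathcal{F}^1(\Omega)$ is the set of 1-fields on $\Omega$ with $\Gamma^1(F;\Omega)<+\infty$. For $\Omega_1\subset\Omega_2$ and $F\in\mathcal{F}^1(\Omega_1)$: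 $G\in\mathcal{F}^1(\Omega_2)$ is an extension of $F$ if $G(x)=F(x)$ for $x\in\Omega_1$; it is a minimal Lipschitz extension (MLE) of $F$ on $\Omega_2$ if moreover $\Gamma^1(G;\Omega_2)=\Gamma^1(F;\Omega_1)$. An MLE $G_1$ of $F$ on $\Omega_2$ is an over extremal Lipschitz extension of $F$ on $\Omega_2$ if $k(x)\le g_1(x)$ for all $x\in\Omega_2$ and every MLE $K$ of $F$ on $\Omega_2$. For $a,b\in\Omega$ and $x\in\mathbb{R}^n$ set $$v_{a,b}=\tfrac12(D_af+D_bf)+\tfrac{\kappa}{2}(b-a),$$ $$\alpha_{a,b}=2\kappa(f_a-f_b)+\kappa\langle D_af+D_bf,b-a\rangle-\tfrac12\|D_af-D_bf\|^2+\tfrac{\kappa^2}{2}\|a-b\|^2,$$ $$\beta_{a,b}(x)=\left\|\tfrac12(D_af-D_bf)+\tfrac{\kappa}{2}(2x-a-b)\right\|^2,\qquad r_{a,b}(x)=\sqrt{\alpha_{a,b}+\beta_{a,b}(x)},$$ (it is known that $\alpha_{a,b}\ge0$), and $$\Lambda_x=\{v\in\mathbb{R}^n:\ \|v-v_{a,b}\|\le r_{a,b}(x)\ \text{for all } a,b\in\Omega\},$$ which is known to be nonempty. For $a\in\Omega$ and $x,v\in\mathbb{R}^n$, $$\Psi^+(F,x,a,v)=f_a+\tfrac12\langle D_af+v,x-a\rangle+\tfrac{\kappa}{4}\|a-x\|^2-\tfrac{1}{4\kappa}\|D_af-v\|^2.$$ The maximum over $\Lambda_x$ is attained at a unique point,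 so $D_xu^+$ is well defined. *)

theory Defs
  imports "HOL-Analysis.Analysis"
begin

text \<open>
  A 1-field is encoded by its data: \<open>F x = (f\<^sub>x, D\<^sub>x f)\<close> represents the polynomial
  \<open>a \<mapsto> f\<^sub>x + \<langle>D\<^sub>x f, a - x\<rangle>\<close>, which determines the pair uniquely.
  Fields are total functions; only the values on the set under consideration matter.
\<close>

type_synonym 'a one_field = "'a \<Rightarrow> real \<times> 'a"

definition val :: "'a one_field \<Rightarrow> 'a \<Rightarrow> real" where
  "val F x = fst (F x)"

definition grad :: "'a one_field \<Rightarrow> 'a \<Rightarrow> 'a" where
  "grad F x = snd (F x)"

definition poly_at :: "'a::real_inner one_field \<Rightarrow> 'a \<Rightarrow> 'a \<Rightarrow> real" where
  "poly_at F x a = val F x + grad F x \<bullet> (a - x)"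

text \<open>
  The suprema are taken in \<open>ennreal\<close>, so that they always exist; the supremum over the empty
  family (no two distinct points) is 0.
\<close>

definition Gamma1_pt :: "'a::real_inner one_field \<Rightarrow> 'a \<Rightarrow> 'a \<Rightarrow> ennreal" where
  "Gamma1_pt F x y =
     2 * (SUP a. ennreal (\<bar>poly_at F x a - poly_at F y a\<bar> / ((norm (x - a))\<^sup>2 + (norm (y - a))\<^sup>2)))"

definition Gamma1 :: "'a::real_inner one_field \<Rightarrow> 'a set \<Rightarrow> ennreal" where
  "Gamma1 F \<Omega> = (SUP x\<in>\<Omega>. SUP y\<in>\<Omega> - {x}. Gamma1_pt F x y)"

definition fields1 :: "'a::real_inner set \<Rightarrow> 'a one_field set" where
  "fields1 \<Omega> = {F. Gamma1 F \<Omega> < \<infinity>}"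

definition is_extension ::
    "'a::real_inner one_field \<Rightarrow> 'a set \<Rightarrow> 'a set \<Rightarrow> 'a one_field \<Rightarrow> bool" where
  "is_extension F \<Omega>\<^sub>1 \<Omega>\<^sub>2 G \<longleftrightarrow>
     \<Omega>\<^sub>1 \<subseteq> \<Omega>\<^sub>2 \<and> F \<in> fields1 \<Omega>\<^sub>1 \<and> G \<in> fields1 \<Omega>\<^sub>2 \<and> (\<forall>x\<in>\<Omega>\<^sub>1. G x = F x)"

definition is_MLE ::
    "'a::real_inner one_field \<Rightarrow> 'a set \<Rightarrow> 'a set \<Rightarrow> 'a one_field \<Rightarrow> bool" where
  "is_MLE F \<Omega>\<^sub>1 \<Omega>\<^sub>2 G \<longleftrightarrow> is_extension F \<Omega>\<^sub>1 \<Omega>\<^sub>2 G \<and> Gamma1 G \<Omega>\<^sub>2 = Gamma1 F \<Omega>\<^sub>1"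

definition is_over_extremal ::
    "'a::real_inner one_field \<Rightarrow> 'a set \<Rightarrow> 'a set \<Rightarrow> 'a one_field \<Rightarrow> bool" where
  "is_over_extremal F \<Omega>\<^sub>1 \<Omega>\<^sub>2 G \<longleftrightarrow>
     is_MLE F \<Omega>\<^sub>1 \<Omega>\<^sub>2 G \<and> (\<forall>K. is_MLE F \<Omega>\<^sub>1 \<Omega>\<^sub>2 K \<longrightarrow> (\<forall>x\<in>\<Omega>\<^sub>2. val K x \<le> val G x))"

text \<open>In the following definitions \<open>\<kappa>\<close> is a parameter, instantiated below with \<open>\<Gamma>\<^sup>1(F; \<Omega>)\<close>.\<close>

definition v_pt :: "real \<Rightarrow> 'a::real_inner one_field \<Rightarrow> 'a \<Rightarrow> 'a \<Rightarrow> 'a" where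
  "v_pt \<kappa> F a b = (1/2) *\<^sub>R (grad F a + grad F b) + (\<kappa>/2) *\<^sub>R (b - a)"

definition alpha :: "real \<Rightarrow> 'a::real_inner one_field \<Rightarrow> 'a \<Rightarrow> 'a \<Rightarrow> real" where
  "alpha \<kappa> F a b = 2 * \<kappa> * (val F a - val F b) + \<kappa> * ((grad F a + grad F b) \<bullet> (b - a))
     - 1/2 * (norm (grad F a - grad F b))\<^sup>2 + \<kappa>\<^sup>2/2 * (norm (a - b))\<^sup>2"

definition beta :: "real \<Rightarrow> 'a::real_inner one_field \<Rightarrow> 'a \<Rightarrow> 'a \<Rightarrow> 'a \<Rightarrow> real" where
  "beta \<kappa> F a b x =
     (norm ((1/2) *\<^sub>R (grad F a - grad F b) + (\<kappa>/2) *\<^sub>R (2 *\<^sub>R x - a - b)))\<^sup>2"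

definition radius :: "real \<Rightarrow> 'a::real_inner one_field \<Rightarrow> 'a \<Rightarrow> 'a \<Rightarrow> 'a \<Rightarrow> real" where
  "radius \<kappa> F a b x = sqrt (alpha \<kappa> F a b + beta \<kappa> F a b x)"

definition Lambda :: "real \<Rightarrow> 'a::real_inner one_field \<Rightarrow> 'a set \<Rightarrow> 'a \<Rightarrow> 'a set" where
  "Lambda \<kappa> F \<Omega> x = {v. \<forall>a\<in>\<Omega>. \<forall>b\<in>\<Omega>. norm (v - v_pt \<kappa> F a b) \<le> radius \<kappa> F a b x}"

definition Psi_plus :: "real \<Rightarrow> 'a::real_inner one_field \<Rightarrow> 'a \<Rightarrow> 'a \<Rightarrow> 'a \<Rightarrow> real" where
  "Psi_plus \<kappa> F x a v = val F a + 1/2 * ((grad F a + v) \<bullet> (x - a))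
     + \<kappa>/4 * (norm (a - x))\<^sup>2 - 1 / (4 * \<kappa>) * (norm (grad F a - v))\<^sup>2"

text \<open>
  For \<open>v \<in> \<Lambda>\<^sub>x\<close> the infimum below is over a set bounded below: the ball conditions defining
  \<open>\<Lambda>\<^sub>x\<close> say precisely that every \<open>\<Psi>\<^sup>+(F, x, a, v)\<close> dominates every \<open>\<Psi>\<^sup>-(F, x, b, v)\<close>, where
  \<open>\<Psi>\<^sup>-\<close> is \<open>\<Psi>\<^sup>+\<close> with the signs of its two quadratic terms reversed.
\<close>

definition inf_Psi :: "real \<Rightarrow> 'a::real_inner one_field \<Rightarrow> 'a set \<Rightarrow> 'a \<Rightarrow> 'a \<Rightarrow> real" where
  "inf_Psi \<kappa> F \<Omega> x v = (INF a\<in>\<Omega>. Psi_plus \<kappa> F x a v)"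

text \<open>
  \<open>GREATEST\<close> is the attained maximum of a possibly infinite set
  (\<open>Max\<close> is only meaningful for finite sets).
\<close>

definition u_plus :: "real \<Rightarrow> 'a::real_inner one_field \<Rightarrow> 'a set \<Rightarrow> 'a \<Rightarrow> real" where
  "u_plus \<kappa> F \<Omega> x = (GREATEST m. m \<in> inf_Psi \<kappa> F \<Omega> x ` Lambda \<kappa> F \<Omega> x)"

definition Du_plus :: "real \<Rightarrow> 'a::real_inner one_field \<Rightarrow> 'a set \<Rightarrow> 'a \<Rightarrow> 'a" where
  "Du_plus \<kappa> F \<Omega> x = arg_max_on (inf_Psi \<kappa> F \<Omega> x) (Lambda \<kappa> F \<Omega> x)"

definition U_plus :: "real \<Rightarrow> 'a::real_inner one_field \<Rightarrow> 'a set \<Rightarrow> 'a one_field" where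
  "U_plus \<kappa> F \<Omega> x = (u_plus \<kappa> F \<Omega> x, Du_plus \<kappa> F \<Omega> x)"

end

theory Submission
  imports Defs
begin

text \<open>
  Why the theorem holds. For a \<open>1\<close>-field \<open>G\<close> on the whole space, \<open>\<Gamma>\<^sup>1(G) \<le> \<kappa>\<close> follows
  as soon as at every point \<open>x\<close> the function \<open>g\<close> lies between the two paraboloids
  \<open>G(x)(z) \<plusminus> \<kappa>/2 \<parallel>z - x\<parallel>\<^sup>2\<close>. Adding \<open>\<kappa>/2 \<parallel>z\<parallel>\<^sup>2\<close> turns the lower
  paraboloids into affine functions, so an extension \<open>g\<close> of \<open>F\<close> corresponds to a convex function
  \<open>g + \<kappa>/2 \<parallel>\<cdot>\<parallel>\<^sup>2\<close> that stays below every
  \<open>q\<^sub>a(z) = F(a)(z) + \<kappa>/2 \<parallel>z - a\<parallel>\<^sup>2 + \<kappa>/2 \<parallel>z\<parallel>\<^sup>2\<close>,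
  \<open>a \<in> \<Omega>\<close>. The largest possible extension must therefore come from the convex envelope \<open>e\<close>
  of the \<open>q\<^sub>a\<close>, that is, \<open>g = e - \<kappa>/2 \<parallel>\<cdot>\<parallel>\<^sup>2\<close>.

  That this \<open>g\<close> also has its upper paraboloids amounts to concavity of
  \<open>e - \<kappa> \<parallel>\<cdot>\<parallel>\<^sup>2\<close>, a property which the \<open>q\<^sub>a\<close> have and
  which passes to the convex envelope (\<open>convex_envelope_semiconcave\<close>). A finite function that is both
  convex and semiconcave is squeezed between an affine function and a paraboloid with the same slope
  at each point (\<open>gradient_if_convex_and_semiconcave\<close>), which supplies the gradients of the
  extension (\<open>maximal_extension_exists\<close>).

  It remains to recognise \<open>g\<close> in the formula for \<open>u\<^sup>+\<close>. Call a jet \<open>(s, v)\<close> at \<open>x\<close> admissible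
  if it is compatible, in the sense of \<open>\<Gamma>\<^sup>1 \<le> \<kappa>\<close>, with every \<open>F(a)\<close>, \<open>a \<in> \<Omega>\<close>.
  Completing squares, this means
  \<open>sup\<^sub>a \<Psi>\<^sup>-(F, x, a, v) \<le> s \<le> inf\<^sub>a \<Psi>\<^sup>+(F, x, a, v)\<close> (\<open>admissible_iff_Psi\<close>),
  and such an \<open>s\<close> exists precisely for \<open>v \<in> \<Lambda>\<^sub>x\<close> (\<open>in_Lambda_iff_Psi\<close>).
  So \<open>u\<^sup>+(x)\<close> is the largest admissible value at \<open>x\<close>. The lower paraboloid of an admissible jet
  is, after adding \<open>\<kappa>/2 \<parallel>\<cdot>\<parallel>\<^sup>2\<close>, one of the affine functions below all the
  \<open>q\<^sub>a\<close>, hence below \<open>e\<close>; thus no admissible value exceeds \<open>g(x)\<close>, and a jet attaining it touches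
  the graph of the differentiable function \<open>g\<close> from below, so its slope is the gradient of \<open>g\<close>.
  This identifies \<open>U\<^sup>+\<close> with the extension and gives both maximality and uniqueness.
\<close>

section \<open>Touching paraboloids and subgradients\<close>

text \<open>
  Used to conclude that two functions touching at \<open>x\<close>, one from below and one from above, have the
  same slope there when their gap is at most quadratic.
\<close>

lemma slope_eq_0_if_below_paraboloid:
  fixes w x :: "'a::real_inner"
  assumes "k > 0" and le: "\<And>z. w \<bullet> (z - x) \<le> k * (norm (z - x))\<^sup>2"
  shows "w = 0"
proof -
  have "k * (norm ((1 / (2 * k)) *\<^sub>R w))\<^sup>2 = (norm w)\<^sup>2 / (4 * k)"
    using \<open>k > 0\<close> by (simp add: power_divide) (simp add: field_simps power2_eq_square)
  then have "(norm w)\<^sup>2 / (2 * k) \<le> (norm w)\<^sup>2 / (4 * k)"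
    using le[of "x + (1 / (2 * k)) *\<^sub>R w"] by (simp add: power2_norm_eq_inner)
  then have "(norm w)\<^sup>2 \<le> 0"
    using \<open>k > 0\<close> by (simp add: field_simps)
  then show ?thesis
    by simp
qed

text \<open>
  A hyperplane separating the point \<open>(x, f x)\<close> from the strict epigraph of \<open>f\<close> is the graph of an
  affine function supporting \<open>f\<close> at \<open>x\<close>.
\<close>

lemma convex_subgradient_exists:
  fixes f :: "'a::euclidean_space \<Rightarrow> real"
  assumes "convex_on UNIV f"
  obtains p where "\<And>z. f z \<ge> f x + p \<bullet> (z - x)"
proof -
  define S where "S = {(z, t). f z < t}"
  have "convex S"
    unfolding convex_def
  proof (clarsimp simp: S_def)
    fix a b s t and u v :: real
    assume "f a < s" "f b < t" "0 \<le> u" "0 \<le> v" "u + v = 1"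
    then have "f (u *\<^sub>R a + v *\<^sub>R b) \<le> u * f a + v * f b"
      using assms by (simp add: convex_on_def)
    also have "\<dots> < u * s + v * t"
    proof (cases "u = 0")
      case True
      then show ?thesis using \<open>u + v = 1\<close> \<open>f b < t\<close> by simp
    next
      case False
      then have "u * f a < u * s" using \<open>0 \<le> u\<close> \<open>f a < s\<close> by simp
      moreover have "v * f b \<le> v * t" using \<open>0 \<le> v\<close> \<open>f b < t\<close> by (simp add: mult_left_mono)
      ultimately show ?thesis by linarith
    qed
    finally show "f (u *\<^sub>R a + v *\<^sub>R b) < u * s + v * t" .
  qed
  moreover have "(x, f x + 1) \<in> S" "(x, f x) \<notin> S"
    by (auto simp: S_def)
  ultimately have "\<exists>n b. n \<noteq> 0 \<and> (\<forall>y\<in>{(x, f x)}. n \<bullet> y \<le> b) \<and> (\<forall>y\<in>S. n \<bullet> y \<ge> b)"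
    by (intro separating_hyperplane_sets) auto
  then obtain n b where "n \<noteq> 0" and nb: "n \<bullet> (x, f x) \<le> b" "\<forall>y\<in>S. b \<le> n \<bullet> y"
    by (metis singletonI)
  obtain p s where n: "n = (p, s)"
    by (cases n)
  have sep: "p \<bullet> x + s * f x \<le> p \<bullet> z + s * t" if "f z < t" for z t
    using nb(1) nb(2)[rule_format, of "(z, t)"] that by (simp add: n S_def)
  have "s \<ge> 0"
    using sep[of x "f x + 1"] by (simp add: algebra_simps)
  \<comment> \<open>The hyperplane is not vertical, because \<open>f\<close> is finite everywhere.\<close>
  have "s \<noteq> 0"
  proof
    assume "s = 0"
    then have "p \<bullet> x \<le> p \<bullet> (x - p)"
      using sep[of "x - p" "f (x - p) + 1"] by simp
    then have "p = 0"
      using inner_ge_zero[of p] by (simp add: inner_diff_right)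
    with \<open>s = 0\<close> \<open>n \<noteq> 0\<close> n show False by (simp add: zero_prod_def)
  qed
  with \<open>s \<ge> 0\<close> have "s > 0" by simp
  have "f z \<ge> f x + (- (1 / s) *\<^sub>R p) \<bullet> (z - x)" for z
  proof (rule dense_ge)
    fix t assume "f z < t"
    from sep[OF this] \<open>s > 0\<close> show "f x + (- (1 / s) *\<^sub>R p) \<bullet> (z - x) \<le> t"
      by (simp add: field_simps inner_diff_right)
  qed
  then show thesis by (rule that)
qed

lemma norm_sq_convex_combination:
  fixes x y :: "'a::real_inner"
  shows "(norm ((1 - t) *\<^sub>R x + t *\<^sub>R y))\<^sup>2
    = (1 - t) * (norm x)\<^sup>2 + t * (norm y)\<^sup>2 - t * (1 - t) * (norm (x - y))\<^sup>2"
  unfolding power2_norm_eq_inner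
  by (simp add: inner_add_left inner_add_right inner_diff_left inner_diff_right
      inner_commute algebra_simps power2_eq_square)

text \<open>
  Semiconcavity as a defect in the concavity inequality of \<open>q\<close> itself. In this form the defect
  depends only on \<open>x - y\<close> and \<open>t\<close>, so it is unaffected by translations.
\<close>

lemma concave_minus_norm_sq_iff:
  fixes q :: "'a::real_inner \<Rightarrow> real"
  shows "concave_on UNIV (\<lambda>z. q z - k * (norm z)\<^sup>2) \<longleftrightarrow>
    (\<forall>x y t. 0 < t \<and> t < 1 \<longrightarrow>
      (1 - t) * q x + t * q y \<le> q ((1 - t) *\<^sub>R x + t *\<^sub>R y) + k * (t * (1 - t) * (norm (x - y))\<^sup>2))"
    (is "?L \<longleftrightarrow> ?R")
proof -
  have eq: "- (q ((1 - t) *\<^sub>R x + t *\<^sub>R y) - k * (norm ((1 - t) *\<^sub>R x + t *\<^sub>R y))\<^sup>2)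
      \<le> (1 - t) * - (q x - k * (norm x)\<^sup>2) + t * - (q y - k * (norm y)\<^sup>2) \<longleftrightarrow>
    (1 - t) * q x + t * q y \<le> q ((1 - t) *\<^sub>R x + t *\<^sub>R y) + k * (t * (1 - t) * (norm (x - y))\<^sup>2)"
    for x y :: 'a and t :: real
  proof -
    define m where "m = (1 - t) *\<^sub>R x + t *\<^sub>R y"
    define d where "d = norm (x - y)"
    have n: "(norm m)\<^sup>2 = (1 - t) * (norm x)\<^sup>2 + t * (norm y)\<^sup>2 - t * (1 - t) * d\<^sup>2"
      unfolding m_def d_def by (rule norm_sq_convex_combination)
    show ?thesis
      unfolding m_def[symmetric] d_def[symmetric] n by (simp add: algebra_simps)
  qed
  show ?thesis
  proof
    assume ?L
    show ?R
    proof (intro allI impI)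
      fix x y :: 'a and t :: real
      assume "0 < t \<and> t < 1"
      with convex_onD[OF \<open>?L\<close>[unfolded concave_on_def], of t x y]
      show "(1 - t) * q x + t * q y
          \<le> q ((1 - t) *\<^sub>R x + t *\<^sub>R y) + k * (t * (1 - t) * (norm (x - y))\<^sup>2)"
        unfolding eq by simp
    qed
  next
    assume ?R
    then show ?L
      unfolding concave_on_def by (intro convex_onI) (simp_all only: eq convex_UNIV simp_thms)
  qed
qed

lemma convex_on_affine:
  fixes w :: "'a::real_inner"
  shows "convex_on UNIV (\<lambda>z. w \<bullet> z + r)"
  by (intro convex_onI) (auto simp: inner_add_right algebra_simps)

text \<open>
  Both \<open>f\<close> and \<open>k \<parallel>\<cdot>\<parallel>\<^sup>2 - f\<close> have a subgradient at \<open>x\<close>. The first bounds \<open>f\<close>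
  from below by an affine function, the second from above by a paraboloid, and as the two bounds
  touch at \<open>x\<close> their slopes agree.
\<close>

lemma gradient_if_convex_and_semiconcave:
  fixes f :: "'a::euclidean_space \<Rightarrow> real"
  assumes "k > 0" and "convex_on UNIV f" and "concave_on UNIV (\<lambda>z. f z - k * (norm z)\<^sup>2)"
  obtains p where "\<And>z. f x + p \<bullet> (z - x) \<le> f z"
    and "\<And>z. f z \<le> f x + p \<bullet> (z - x) + k * (norm (z - x))\<^sup>2"
proof -
  obtain p where p: "\<And>z. f x + p \<bullet> (z - x) \<le> f z"
    using convex_subgradient_exists[OF assms(2)] by blast
  obtain r where r: "\<And>z. - (f x - k * (norm x)\<^sup>2) + r \<bullet> (z - x) \<le> - (f z - k * (norm z)\<^sup>2)"
    using convex_subgradient_exists[OF assms(3)[unfolded concave_on_def]] by blast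
  \<comment> \<open>The slope at \<open>x\<close> of the upper bound for \<open>f\<close>: \<open>2 k x\<close> is the gradient of \<open>k \<parallel>\<cdot>\<parallel>\<^sup>2\<close>.\<close>
  define p' where "p' = (2 * k) *\<^sub>R x - r"
  have p': "f z \<le> f x + p' \<bullet> (z - x) + k * (norm (z - x))\<^sup>2" for z
    using r[of z] unfolding p'_def power2_norm_eq_inner
    by (simp add: inner_diff_left inner_diff_right inner_commute algebra_simps)
  have "p - p' = 0"
  proof (rule slope_eq_0_if_below_paraboloid[OF \<open>k > 0\<close>])
    show "(p - p') \<bullet> (z - x) \<le> k * (norm (z - x))\<^sup>2" for z
      using p[of z] p'[of z] by (simp add: inner_diff_left)
  qed
  then have "p' = p" by simp
  show thesis
    by (rule that[OF p p'[unfolded \<open>p' = p\<close>]])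
qed

section \<open>The largest convex function below a family\<close>

definition convex_minorants :: "('a::real_vector \<Rightarrow> real) set \<Rightarrow> ('a \<Rightarrow> real) set" where
  "convex_minorants Q = {c. convex_on UNIV c \<and> (\<forall>q\<in>Q. \<forall>z. c z \<le> q z)}"

definition convex_envelope :: "('a::real_vector \<Rightarrow> real) set \<Rightarrow> 'a \<Rightarrow> real" where
  "convex_envelope Q z = (SUP c\<in>convex_minorants Q. c z)"

lemma le_convex_envelope:
  assumes "Q \<noteq> {}" and "c \<in> convex_minorants Q"
  shows "c z \<le> convex_envelope Q z"
  unfolding convex_envelope_def
proof (rule cSUP_upper[OF assms(2)])
  obtain q where "q \<in> Q" using assms(1) by blast
  then show "bdd_above ((\<lambda>c. c z) ` convex_minorants Q)"
    by (auto intro!: bdd_aboveI[of _ "q z"] simp: convex_minorants_def)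
qed

lemma convex_envelope_in_convex_minorants:
  assumes "Q \<noteq> {}" and "convex_minorants Q \<noteq> {}"
  shows "convex_envelope Q \<in> convex_minorants Q"
proof -
  have "convex_on UNIV (convex_envelope Q)"
  proof (rule convex_onI)
    fix t :: real and x y :: 'a
    assume t: "0 < t" "t < 1"
    show "convex_envelope Q ((1 - t) *\<^sub>R x + t *\<^sub>R y)
      \<le> (1 - t) * convex_envelope Q x + t * convex_envelope Q y"
      unfolding convex_envelope_def[of Q "(1 - t) *\<^sub>R x + t *\<^sub>R y"]
    proof (rule cSUP_least[OF assms(2)])
      fix c assume c: "c \<in> convex_minorants Q"
      then have "c ((1 - t) *\<^sub>R x + t *\<^sub>R y) \<le> (1 - t) * c x + t * c y"
        using convex_onD[of UNIV c t x y] t by (simp add: convex_minorants_def)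
      also have "\<dots> \<le> (1 - t) * convex_envelope Q x + t * convex_envelope Q y"
        using t le_convex_envelope[OF assms(1) c] by (intro add_mono mult_left_mono) auto
      finally show "c ((1 - t) *\<^sub>R x + t *\<^sub>R y)
        \<le> (1 - t) * convex_envelope Q x + t * convex_envelope Q y" .
    qed
  qed simp
  moreover have "convex_envelope Q z \<le> q z" if "q \<in> Q" for q z
    unfolding convex_envelope_def
    using assms(2) that by (intro cSUP_least) (auto simp: convex_minorants_def)
  ultimately show ?thesis
    by (simp add: convex_minorants_def)
qed

lemma convex_on_translate:
  assumes "convex_on UNIV f"
  shows "convex_on UNIV (\<lambda>z. f (z + d))"
proof (rule convex_onI)
  fix t :: real and x y
  assume "0 < t" "t < 1"
  moreover have "(1 - t) *\<^sub>R x + t *\<^sub>R y + d = (1 - t) *\<^sub>R (x + d) + t *\<^sub>R (y + d)"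
    by (simp add: algebra_simps)
  ultimately show "f ((1 - t) *\<^sub>R x + t *\<^sub>R y + d) \<le> (1 - t) * f (x + d) + t * f (y + d)"
    using convex_onD[OF assms, of t "x + d" "y + d"] by simp
qed simp

text \<open>
  Fix \<open>x\<close>, \<open>y\<close> and a convex combination \<open>m\<close> of them. Averaging the translates of the envelope by
  \<open>x - m\<close> and \<open>y - m\<close> gives a convex function, and by semiconcavity of each \<open>q \<in> Q\<close> it exceeds \<open>q\<close>
  by at most the constant \<open>d\<close>. Lowered by \<open>d\<close> it is a convex minorant, so it lies below the envelope;
  at \<open>m\<close> this is the inequality wanted.
\<close>

lemma convex_envelope_semiconcave:
  fixes Q :: "('a::real_inner \<Rightarrow> real) set"
  assumes "Q \<noteq> {}" and "convex_minorants Q \<noteq> {}"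
    and Q: "\<And>q. q \<in> Q \<Longrightarrow> concave_on UNIV (\<lambda>z. q z - k * (norm z)\<^sup>2)"
  shows "concave_on UNIV (\<lambda>z. convex_envelope Q z - k * (norm z)\<^sup>2)"
  unfolding concave_minus_norm_sq_iff
proof (intro allI impI)
  fix x y :: 'a and t :: real
  assume t: "0 < t \<and> t < 1"
  let ?e = "convex_envelope Q"
  define d where "d = k * (t * (1 - t) * (norm (x - y))\<^sup>2)"
  define m where "m = (1 - t) *\<^sub>R x + t *\<^sub>R y"
  define \<psi> where "\<psi> z = (1 - t) * ?e (z + (x - m)) + t * ?e (z + (y - m)) + - d" for z
  have e: "convex_on UNIV ?e" "\<And>q z. q \<in> Q \<Longrightarrow> ?e z \<le> q z"
    using convex_envelope_in_convex_minorants[OF assms(1,2)] by (auto simp: convex_minorants_def)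
  have "convex_on UNIV \<psi>"
  proof -
    have "convex_on UNIV (\<lambda>z. (1 - t) * ?e (z + (x - m)))" "convex_on UNIV (\<lambda>z. t * ?e (z + (y - m)))"
      using t by (auto intro!: convex_on_cmul[OF _ convex_on_translate[OF e(1)]])
    moreover have "convex_on UNIV (\<lambda>z::'a. - d)"
      by (simp add: convex_on_const)
    ultimately show ?thesis
      unfolding \<psi>_def by (rule convex_on_add[OF convex_on_add])
  qed
  moreover have "\<psi> z \<le> q z" if "q \<in> Q" for q z
  proof -
    have "\<psi> z \<le> (1 - t) * q (z + (x - m)) + t * q (z + (y - m)) + - d"
      unfolding \<psi>_def using t e(2)[OF that] by (intro add_mono mult_left_mono) auto
    also have "\<dots> \<le> q ((1 - t) *\<^sub>R (z + (x - m)) + t *\<^sub>R (z + (y - m)))"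
      using Q[OF that, unfolded concave_minus_norm_sq_iff, rule_format,
          of t "z + (x - m)" "z + (y - m)"] t
      by (simp add: d_def)
    also have "(1 - t) *\<^sub>R (z + (x - m)) + t *\<^sub>R (z + (y - m)) = z"
      by (simp add: m_def algebra_simps)
    finally show ?thesis .
  qed
  ultimately have "\<psi> \<in> convex_minorants Q"
    by (simp add: convex_minorants_def)
  from le_convex_envelope[OF assms(1) this, of m]
  show "(1 - t) * ?e x + t * ?e y
    \<le> ?e ((1 - t) *\<^sub>R x + t *\<^sub>R y) + k * (t * (1 - t) * (norm (x - y))\<^sup>2)"
    by (simp add: \<psi>_def d_def flip: m_def)
qed

section \<open>Admissible jets\<close>

text \<open>
  The jet \<open>(s, v)\<close> could be the value at \<open>x\<close> of an extension of \<open>F\<close> with the constant \<open>\<kappa>\<close>: it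
  satisfies with each \<open>F a\<close> the inequality that \<open>\<Gamma>\<^sup>1 \<le> \<kappa>\<close> demands, cleared of its denominator.
\<close>

definition admissible ::
    "real \<Rightarrow> 'a::real_inner one_field \<Rightarrow> 'a set \<Rightarrow> 'a \<Rightarrow> real \<Rightarrow> 'a \<Rightarrow> bool" where
  "admissible \<kappa> F \<Omega> x s v \<longleftrightarrow> (\<forall>a\<in>\<Omega>. \<forall>c.
     \<bar>poly_at F a c - (s + v \<bullet> (c - x))\<bar> \<le> \<kappa> / 2 * ((norm (a - c))\<^sup>2 + (norm (x - c))\<^sup>2))"

lemma Gamma1_le_iff:
  fixes F :: "'a::real_inner one_field"
  assumes "\<kappa> \<ge> 0"
  shows "Gamma1 F S \<le> ennreal \<kappa> \<longleftrightarrow> (\<forall>x\<in>S. admissible \<kappa> F S x (val F x) (grad F x))"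
proof -
  define near where "near x y \<longleftrightarrow> (\<forall>c. \<bar>poly_at F x c - poly_at F y c\<bar>
      \<le> \<kappa> / 2 * ((norm (x - c))\<^sup>2 + (norm (y - c))\<^sup>2))" for x y
  have near_refl: "near x x" for x
    using assms by (simp add: near_def)
  have near_iff: "Gamma1_pt F x y \<le> ennreal \<kappa> \<longleftrightarrow> near x y" if "x \<noteq> y" for x y
  proof -
    have "2 * ennreal (\<bar>r\<bar> / ((norm (x - c))\<^sup>2 + (norm (y - c))\<^sup>2)) \<le> ennreal \<kappa> \<longleftrightarrow>
        \<bar>r\<bar> \<le> \<kappa> / 2 * ((norm (x - c))\<^sup>2 + (norm (y - c))\<^sup>2)" for r c
    proof -
      have pos: "(norm (x - c))\<^sup>2 + (norm (y - c))\<^sup>2 > 0"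
        using that by (auto simp: sum_power2_gt_zero_iff)
      have "2 * ennreal (\<bar>r\<bar> / ((norm (x - c))\<^sup>2 + (norm (y - c))\<^sup>2))
          = ennreal (2 * (\<bar>r\<bar> / ((norm (x - c))\<^sup>2 + (norm (y - c))\<^sup>2)))"
        by (subst ennreal_mult') simp_all
      then show ?thesis
        using assms pos by (simp add: ennreal_le_iff field_simps)
    qed
    then show ?thesis
      unfolding Gamma1_pt_def near_def by (simp add: SUP_mult_left_ennreal SUP_le_iff)
  qed
  have "Gamma1 F S \<le> ennreal \<kappa> \<longleftrightarrow> (\<forall>x\<in>S. \<forall>y\<in>S - {x}. Gamma1_pt F x y \<le> ennreal \<kappa>)"
    unfolding Gamma1_def by (simp add: SUP_le_iff)
  also have "\<dots> \<longleftrightarrow> (\<forall>x\<in>S. \<forall>y\<in>S. near y x)"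
    using near_iff near_refl by (metis Diff_iff singleton_iff)
  also have "\<dots> \<longleftrightarrow> (\<forall>x\<in>S. admissible \<kappa> F S x (val F x) (grad F x))"
    unfolding admissible_def near_def poly_at_def by blast
  finally show ?thesis .
qed

lemma Gamma1_mono: "S \<subseteq> T \<Longrightarrow> Gamma1 F S \<le> Gamma1 F T"
  unfolding Gamma1_def by (rule SUP_subset_mono, assumption, rule SUP_subset_mono) auto

lemma Gamma1_cong:
  assumes "\<And>x. x \<in> S \<Longrightarrow> F x = G x"
  shows "Gamma1 F S = Gamma1 G S"
  unfolding Gamma1_def Gamma1_pt_def poly_at_def val_def grad_def
  by (rule SUP_cong, rule refl, rule SUP_cong, rule refl) (simp add: assms)

text \<open>
  The counterpart of \<open>\<Psi>\<^sup>+\<close> in which the two quadratic terms change sign; it bounds admissible values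
  from below as \<open>\<Psi>\<^sup>+\<close> bounds them from above.
\<close>

definition Psi_minus :: "real \<Rightarrow> 'a::real_inner one_field \<Rightarrow> 'a \<Rightarrow> 'a \<Rightarrow> 'a \<Rightarrow> real" where
  "Psi_minus \<kappa> F x a v = val F a + 1/2 * ((grad F a + v) \<bullet> (x - a))
     - \<kappa>/4 * (norm (a - x))\<^sup>2 + 1 / (4 * \<kappa>) * (norm (grad F a - v))\<^sup>2"

text \<open>
  For \<open>\<kappa> > 0\<close> the minimum over \<open>c\<close> of the left-hand side is \<open>\<Psi>\<^sup>+(F, x, a, v) - s\<close>. Its minimiser is the
  midpoint of \<open>a\<close> and \<open>x\<close>, displaced against the difference of the slopes. The companion identity
  after it treats the opposite sign of the difference of the two polynomials.
\<close>

lemma poly_diff_complete_square_plus: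
  fixes x v :: "'a::real_inner"
  assumes "\<kappa> \<noteq> 0"
  shows "poly_at F a c - (s + v \<bullet> (c - x)) + \<kappa> / 2 * ((norm (a - c))\<^sup>2 + (norm (x - c))\<^sup>2)
    = Psi_plus \<kappa> F x a v - s
      + \<kappa> * (norm (c - (1/2) *\<^sub>R (a + x) + (1 / (2 * \<kappa>)) *\<^sub>R (grad F a - v)))\<^sup>2"
proof -
  define w where "w = (1 / (2 * \<kappa>)) *\<^sub>R (grad F a - v)"
  \<comment> \<open>Expressing the gradient through \<open>w\<close> makes both sides polynomial in \<open>\<kappa>\<close>.\<close>
  have D: "grad F a = v + (2 * \<kappa>) *\<^sub>R w"
    using assms by (simp add: w_def)
  have n: "1 / (4 * \<kappa>) * (norm (grad F a - v))\<^sup>2 = \<kappa> * (norm w)\<^sup>2"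
    using assms by (simp add: D power_mult_distrib) (simp add: power2_eq_square)
  show ?thesis
    unfolding poly_at_def Psi_plus_def n w_def[symmetric] unfolding D power2_norm_eq_inner
    by (simp add: inner_add_left inner_add_right inner_diff_left inner_diff_right
      inner_commute algebra_simps)
qed

lemma poly_diff_complete_square_minus:
  fixes x v :: "'a::real_inner"
  assumes "\<kappa> \<noteq> 0"
  shows "s + v \<bullet> (c - x) - poly_at F a c + \<kappa> / 2 * ((norm (a - c))\<^sup>2 + (norm (x - c))\<^sup>2)
    = s - Psi_minus \<kappa> F x a v
      + \<kappa> * (norm (c - (1/2) *\<^sub>R (a + x) - (1 / (2 * \<kappa>)) *\<^sub>R (grad F a - v)))\<^sup>2"
proof -
  define w where "w = (1 / (2 * \<kappa>)) *\<^sub>R (grad F a - v)"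
  \<comment> \<open>Expressing the gradient through \<open>w\<close> makes both sides polynomial in \<open>\<kappa>\<close>.\<close>
  have D: "grad F a = v + (2 * \<kappa>) *\<^sub>R w"
    using assms by (simp add: w_def)
  have n: "1 / (4 * \<kappa>) * (norm (grad F a - v))\<^sup>2 = \<kappa> * (norm w)\<^sup>2"
    using assms by (simp add: D power_mult_distrib) (simp add: power2_eq_square)
  show ?thesis
    unfolding poly_at_def Psi_minus_def n w_def[symmetric] unfolding D power2_norm_eq_inner
    by (simp add: inner_add_left inner_add_right inner_diff_left inner_diff_right
      inner_commute algebra_simps)
qed

lemma admissible_iff_Psi:
  fixes x v :: "'a::real_inner"
  assumes "\<kappa> > 0"
  shows "admissible \<kappa> F \<Omega> x s v \<longleftrightarrow>
    (\<forall>a\<in>\<Omega>. Psi_minus \<kappa> F x a v \<le> s \<and> s \<le> Psi_plus \<kappa> F x a v)"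
proof -
  have "(\<forall>c. \<bar>poly_at F a c - (s + v \<bullet> (c - x))\<bar>
        \<le> \<kappa> / 2 * ((norm (a - c))\<^sup>2 + (norm (x - c))\<^sup>2)) \<longleftrightarrow>
      Psi_minus \<kappa> F x a v \<le> s \<and> s \<le> Psi_plus \<kappa> F x a v" (is "(\<forall>c. ?P c) \<longleftrightarrow> ?Q") for a
  proof
    let ?m = "(1/2) *\<^sub>R (a + x)" and ?w = "(1 / (2 * \<kappa>)) *\<^sub>R (grad F a - v)"
    assume P: "\<forall>c. ?P c"
    have "?m - ?w - ?m + ?w = 0" "?m + ?w - ?m - ?w = 0" and "\<kappa> \<noteq> 0"
      using assms by simp_all
    note zero = this(1,2)[THEN arg_cong[where f="\<lambda>y. \<kappa> * (norm y)\<^sup>2"], unfolded norm_zero zero_power2 mult_zero_right]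
    from P[rule_format, of "?m - ?w"] P[rule_format, of "?m + ?w"] zero show ?Q
      using poly_diff_complete_square_plus[OF \<open>\<kappa> \<noteq> 0\<close>, of F a "?m - ?w" s v x]
        poly_diff_complete_square_minus[OF \<open>\<kappa> \<noteq> 0\<close>, of s v "?m + ?w" x F a]
      by linarith
  next
    assume Q: ?Q
    show "\<forall>c. ?P c"
    proof
      fix c
      have "\<kappa> * (norm y)\<^sup>2 \<ge> 0" for y :: 'a
        using assms by simp
      note this[of "c - (1/2) *\<^sub>R (a + x) + (1 / (2 * \<kappa>)) *\<^sub>R (grad F a - v)"]
        this[of "c - (1/2) *\<^sub>R (a + x) - (1 / (2 * \<kappa>)) *\<^sub>R (grad F a - v)"]
      with Q show "?P c"
        using poly_diff_complete_square_plus[of \<kappa> F a c s v x]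
          poly_diff_complete_square_minus[of \<kappa> s v c x F a] assms
        by linarith
    qed
  qed
  then show ?thesis
    by (simp add: admissible_def)
qed

text \<open>
  The terms of \<open>\<Psi>\<^sup>+ - \<Psi>\<^sup>-\<close> quadratic in \<open>v\<close> add up to \<open>- \<parallel>v\<parallel>\<^sup>2 / (2 \<kappa>)\<close>, so that the set
  of \<open>v\<close> where \<open>\<Psi>\<^sup>+ - \<Psi>\<^sup>-\<close> is nonnegative is a ball: this is where its centre \<open>v\<^sub>a\<^sub>b\<close> and its squared
  radius \<open>\<alpha>\<^sub>a\<^sub>b + \<beta>\<^sub>a\<^sub>b(x)\<close> come from.
\<close>

lemma radius_gap_eq_Psi_gap:
  fixes x v :: "'a::real_inner"
  assumes "\<kappa> \<noteq> 0"
  shows "alpha \<kappa> F a b + beta \<kappa> F a b x - (norm (v - v_pt \<kappa> F a b))\<^sup>2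
    = 2 * \<kappa> * (Psi_plus \<kappa> F x a v - Psi_minus \<kappa> F x b v)"
proof -
  have n: "2 * \<kappa> * (1 / (4 * \<kappa>) * r) = r / 2" for r
    using assms by simp
  show ?thesis
    unfolding alpha_def beta_def v_pt_def Psi_plus_def Psi_minus_def
      right_diff_distrib[of "2 * \<kappa>"] distrib_left[of "2 * \<kappa>"] n
    unfolding power2_norm_eq_inner
    by (simp add: inner_add_left inner_add_right inner_diff_left inner_diff_right
      inner_commute algebra_simps power2_eq_square) (simp add: field_simps)
qed

lemma in_Lambda_iff_Psi:
  fixes x v :: "'a::real_inner"
  assumes "\<kappa> > 0"
  shows "v \<in> Lambda \<kappa> F \<Omega> x \<longleftrightarrow> (\<forall>a\<in>\<Omega>. \<forall>b\<in>\<Omega>. Psi_minus \<kappa> F x b v \<le> Psi_plus \<kappa> F x a v)"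
proof -
  have "norm (v - v_pt \<kappa> F a b) \<le> radius \<kappa> F a b x \<longleftrightarrow> Psi_minus \<kappa> F x b v \<le> Psi_plus \<kappa> F x a v"
    for a b
  proof -
    \<comment> \<open>The square root is monotone on all of \<open>\<real>\<close>, so a negative radicand is covered as well.\<close>
    have "norm (v - v_pt \<kappa> F a b) \<le> radius \<kappa> F a b x \<longleftrightarrow>
        sqrt ((norm (v - v_pt \<kappa> F a b))\<^sup>2) \<le> sqrt (alpha \<kappa> F a b + beta \<kappa> F a b x)"
      by (simp add: radius_def)
    also have "\<dots> \<longleftrightarrow> 0 \<le> 2 * \<kappa> * (Psi_plus \<kappa> F x a v - Psi_minus \<kappa> F x b v)"
      using radius_gap_eq_Psi_gap[of \<kappa> F a b x v] assms
      unfolding real_sqrt_le_iff by linarith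
    also have "\<dots> \<longleftrightarrow> Psi_minus \<kappa> F x b v \<le> Psi_plus \<kappa> F x a v"
      using assms by (simp add: zero_le_mult_iff)
    finally show ?thesis .
  qed
  then show ?thesis
    by (simp add: Lambda_def)
qed

lemma admissible_imp_Lambda:
  fixes x v :: "'a::real_inner"
  assumes "\<kappa> > 0" "\<Omega> \<noteq> {}" "admissible \<kappa> F \<Omega> x s v"
  shows "v \<in> Lambda \<kappa> F \<Omega> x" "s \<le> inf_Psi \<kappa> F \<Omega> x v"
proof -
  have adm: "\<forall>a\<in>\<Omega>. Psi_minus \<kappa> F x a v \<le> s \<and> s \<le> Psi_plus \<kappa> F x a v"
    using assms by (simp add: admissible_iff_Psi)
  then show "v \<in> Lambda \<kappa> F \<Omega> x"
    using assms(1) by (auto simp: in_Lambda_iff_Psi intro: order_trans)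
  show "s \<le> inf_Psi \<kappa> F \<Omega> x v"
    unfolding inf_Psi_def using assms(2) adm by (intro cINF_greatest) auto
qed

lemma Lambda_imp_admissible_inf_Psi:
  fixes x v :: "'a::real_inner"
  assumes "\<kappa> > 0" "\<Omega> \<noteq> {}" "v \<in> Lambda \<kappa> F \<Omega> x"
  shows "admissible \<kappa> F \<Omega> x (inf_Psi \<kappa> F \<Omega> x v) v"
  unfolding admissible_iff_Psi[OF assms(1)]
proof (intro ballI conjI)
  fix b assume b: "b \<in> \<Omega>"
  have le: "\<forall>a\<in>\<Omega>. Psi_minus \<kappa> F x b v \<le> Psi_plus \<kappa> F x a v"
    using assms(1,3) b by (simp add: in_Lambda_iff_Psi)
  then show "Psi_minus \<kappa> F x b v \<le> inf_Psi \<kappa> F \<Omega> x v"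
    unfolding inf_Psi_def using assms(2) by (intro cINF_greatest) auto
  show "inf_Psi \<kappa> F \<Omega> x v \<le> Psi_plus \<kappa> F x b v"
    unfolding inf_Psi_def using le b by (intro cINF_lower bdd_belowI2) auto
qed

section \<open>The maximal extension\<close>

text \<open>
  The extension is \<open>g = e - \<kappa>/2 \<parallel>\<cdot>\<parallel>\<^sup>2\<close> for the convex envelope \<open>e\<close> of the functions
  \<open>q\<^sub>a\<close>. Every admissible jet yields an affine function below all \<open>q\<^sub>a\<close>, hence a paraboloid
  below \<open>g\<close>; this single fact shows that \<open>g\<close> agrees with \<open>F\<close> on \<open>\<Omega>\<close>, as the jets of \<open>F\<close> there are
  admissible, that \<open>g\<close> dominates all admissible values, and that the slope of an admissible jet with
  value \<open>g(x)\<close> is unique.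
\<close>

lemma maximal_extension_exists:
  fixes F :: "('a::euclidean_space) one_field"
  assumes "\<kappa> > 0" and "\<Omega> \<noteq> {}"
    and F: "\<And>a. a \<in> \<Omega> \<Longrightarrow> admissible \<kappa> F \<Omega> a (val F a) (grad F a)"
  obtains G where "\<And>x. admissible \<kappa> G UNIV x (val G x) (grad G x)"
    and "\<And>x. x \<in> \<Omega> \<Longrightarrow> G x = F x"
    and "\<And>x s v. admissible \<kappa> F \<Omega> x s v \<Longrightarrow> s \<le> val G x"
    and "\<And>x v. admissible \<kappa> F \<Omega> x (val G x) v \<Longrightarrow> v = grad G x"
proof -
  define q where "q a z = poly_at F a z + \<kappa> / 2 * (norm (a - z))\<^sup>2 + \<kappa> / 2 * (norm z)\<^sup>2" for a z
  let ?Q = "q ` \<Omega>"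
  define e where "e = convex_envelope ?Q"
  define g where "g z = e z - \<kappa> / 2 * (norm z)\<^sup>2" for z
  have Q: "?Q \<noteq> {}"
    using \<open>\<Omega> \<noteq> {}\<close> by simp
  have minorant: "(\<lambda>z. s + v \<bullet> (z - x) - \<kappa> / 2 * (norm (x - z))\<^sup>2 + \<kappa> / 2 * (norm z)\<^sup>2)
      \<in> convex_minorants ?Q" (is "?c \<in> _") if "admissible \<kappa> F \<Omega> x s v" for x s v
  proof -
    have "?c = (\<lambda>z. (v + \<kappa> *\<^sub>R x) \<bullet> z + (s - v \<bullet> x - \<kappa> / 2 * (norm x)\<^sup>2))"
      unfolding power2_norm_eq_inner
      by (simp add: fun_eq_iff inner_add_left inner_add_right inner_diff_left inner_diff_right
          inner_commute algebra_simps)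
    then have "convex_on UNIV ?c"
      by (simp only: convex_on_affine)
    moreover have "?c z \<le> q a z" if "a \<in> \<Omega>" for a z
    proof -
      have "\<bar>poly_at F a z - (s + v \<bullet> (z - x))\<bar> \<le> \<kappa> / 2 * ((norm (a - z))\<^sup>2 + (norm (x - z))\<^sup>2)"
        using \<open>admissible \<kappa> F \<Omega> x s v\<close> that by (simp add: admissible_def)
      then show ?thesis
        unfolding q_def distrib_left by linarith
    qed
    ultimately show ?thesis
      unfolding convex_minorants_def by blast
  qed
  have minorants: "convex_minorants ?Q \<noteq> {}"
    using minorant F \<open>\<Omega> \<noteq> {}\<close> by blast
  have e: "convex_on UNIV e" "\<And>a z. a \<in> \<Omega> \<Longrightarrow> e z \<le> q a z"
    using convex_envelope_in_convex_minorants[OF Q minorants]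
    by (auto simp: convex_minorants_def e_def)
  have g_ge: "s + v \<bullet> (z - x) - \<kappa> / 2 * (norm (x - z))\<^sup>2 \<le> g z" if "admissible \<kappa> F \<Omega> x s v" for x s v z
    using le_convex_envelope[OF Q minorant[OF that], of z] by (simp add: g_def e_def)
  have "concave_on UNIV (\<lambda>z. q a z - \<kappa> * (norm z)\<^sup>2)" for a
  proof -
    have "(\<lambda>z. - (q a z - \<kappa> * (norm z)\<^sup>2))
        = (\<lambda>z. (\<kappa> *\<^sub>R a - grad F a) \<bullet> z + (grad F a \<bullet> a - val F a - \<kappa> / 2 * (norm a)\<^sup>2))"
      unfolding q_def poly_at_def power2_norm_eq_inner
      by (simp add: fun_eq_iff inner_add_left inner_add_right inner_diff_left inner_diff_right
          inner_commute algebra_simps)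
    moreover have "convex_on UNIV \<dots>"
      by (rule convex_on_affine)
    ultimately show ?thesis
      by (simp add: concave_on_def)
  qed
  then have "concave_on UNIV (\<lambda>z. e z - \<kappa> * (norm z)\<^sup>2)"
    unfolding e_def using Q minorants by (intro convex_envelope_semiconcave) auto
  then have "\<exists>p. \<forall>z. e x + p \<bullet> (z - x) \<le> e z \<and>
      e z \<le> e x + p \<bullet> (z - x) + \<kappa> * (norm (z - x))\<^sup>2" for x
    using gradient_if_convex_and_semiconcave[OF \<open>\<kappa> > 0\<close> e(1), of x] by metis
  then obtain p where p: "\<And>x z. e x + p x \<bullet> (z - x) \<le> e z"
      "\<And>x z. e z \<le> e x + p x \<bullet> (z - x) + \<kappa> * (norm (z - x))\<^sup>2"
    by metis
  define G where "G x = (g x, p x - \<kappa> *\<^sub>R x)" for x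
  have val_G: "val G x = g x" and grad_G: "grad G x = p x - \<kappa> *\<^sub>R x" for x
    by (simp_all add: G_def val_def grad_def)
  have lower: "poly_at G x z - \<kappa> / 2 * (norm (x - z))\<^sup>2 \<le> g z"
    and upper: "g z \<le> poly_at G x z + \<kappa> / 2 * (norm (x - z))\<^sup>2" for x z
    using p(1)[of x z] p(2)[of z x]
    unfolding poly_at_def val_G grad_G g_def power2_norm_eq_inner
    by (simp_all add: inner_diff_left inner_diff_right inner_commute algebra_simps)
  have slope: "v = grad G x" if "admissible \<kappa> F \<Omega> x (g x) v" for x v
  proof -
    have "v - grad G x = 0"
    proof (rule slope_eq_0_if_below_paraboloid[OF \<open>\<kappa> > 0\<close>])
      show "(v - grad G x) \<bullet> (z - x) \<le> \<kappa> * (norm (z - x))\<^sup>2" for z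
        using g_ge[OF that, of z] upper[of z x]
        by (simp add: poly_at_def val_G inner_diff_left norm_minus_commute)
    qed
    then show ?thesis by simp
  qed
  show thesis
  proof (rule that[of G])
    show "admissible \<kappa> G UNIV x (val G x) (grad G x)" for x
      unfolding admissible_def
    proof (intro ballI allI)
      fix a c
      show "\<bar>poly_at G a c - (val G x + grad G x \<bullet> (c - x))\<bar>
          \<le> \<kappa> / 2 * ((norm (a - c))\<^sup>2 + (norm (x - c))\<^sup>2)"
        unfolding poly_at_def[of G x c, symmetric]
        using lower[of a c] upper[of c a] lower[of x c] upper[of c x]
        by (simp add: distrib_left)
    qed
    show "G x = F x" if "x \<in> \<Omega>" for x
    proof -
      have "val F x = g x"
        using g_ge[OF F[OF that], of x] e(2)[OF that, of x]
        by (simp add: g_def q_def poly_at_def)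
      with slope[of x "grad F x"] F[OF that] show ?thesis
        by (simp add: prod_eq_iff flip: val_def grad_def) (simp add: val_G)
    qed
    show "s \<le> val G x" if "admissible \<kappa> F \<Omega> x s v" for x s v
      using g_ge[OF that, of x] by (simp add: val_G)
    show "v = grad G x" if "admissible \<kappa> F \<Omega> x (val G x) v" for x v
      using that slope by (simp add: val_G)
  qed
qed

text \<open>
  Links competitors to admissible jets: an extension with the same constant is compatible with its
  own values on \<open>\<Omega>\<close>, which are those of \<open>F\<close>.
\<close>

lemma MLE_imp_admissible:
  assumes "\<kappa> \<ge> 0" and "Gamma1 F \<Omega> = ennreal \<kappa>" and "is_MLE F \<Omega> UNIV K"
  shows "admissible \<kappa> F \<Omega> x (val K x) (grad K x)"
proof -
  have "admissible \<kappa> K UNIV x (val K x) (grad K x)" and "\<forall>a\<in>\<Omega>. K a = F a"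
    using assms Gamma1_le_iff[of \<kappa> K UNIV] by (auto simp: is_MLE_def is_extension_def)
  then show ?thesis
    unfolding admissible_def poly_at_def val_def grad_def by (metis UNIV_I)
qed

theorem theorem20:
  fixes \<Omega> :: "(real ^ 'n) set" and F :: "(real ^ 'n) one_field" and \<kappa> :: real
  assumes "\<Omega> \<noteq> {}"
    and "F \<in> fields1 \<Omega>"
    and "\<kappa> = enn2real (Gamma1 F \<Omega>)"
    and "\<kappa> > 0"
  shows "is_over_extremal F \<Omega> UNIV (U_plus \<kappa> F \<Omega>) \<and>
    (\<forall>G. is_over_extremal F \<Omega> UNIV G \<longrightarrow> G = U_plus \<kappa> F \<Omega>)"
proof -
  have \<kappa>: "Gamma1 F \<Omega> = ennreal \<kappa>"
    using assms(2,3) by (simp add: fields1_def)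
  then have "admissible \<kappa> F \<Omega> a (val F a) (grad F a)" if "a \<in> \<Omega>" for a
    using that Gamma1_le_iff[of \<kappa> F \<Omega>] assms(4) by simp
  from maximal_extension_exists[OF assms(4,1) this]
  obtain G where G: "\<And>x. admissible \<kappa> G UNIV x (val G x) (grad G x)"
    and ext: "\<And>x. x \<in> \<Omega> \<Longrightarrow> G x = F x"
    and max: "\<And>x s v. admissible \<kappa> F \<Omega> x s v \<Longrightarrow> s \<le> val G x"
    and slope: "\<And>x v. admissible \<kappa> F \<Omega> x (val G x) v \<Longrightarrow> v = grad G x"
    by blast
  have "Gamma1 G UNIV = Gamma1 F \<Omega>"
  proof (rule antisym)
    show "Gamma1 G UNIV \<le> Gamma1 F \<Omega>"
      using G Gamma1_le_iff[of \<kappa> G UNIV] assms(4) \<kappa> by simp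
    show "Gamma1 F \<Omega> \<le> Gamma1 G UNIV"
      using Gamma1_cong[of \<Omega> G F] ext Gamma1_mono[of \<Omega> UNIV G] by simp
  qed
  then have MLE: "is_MLE F \<Omega> UNIV G"
    using assms(2) ext by (simp add: is_MLE_def is_extension_def fields1_def)
  note adm = MLE_imp_admissible[OF less_imp_le[OF assms(4)] \<kappa>]
  have extremal: "is_over_extremal F \<Omega> UNIV G"
    using MLE max[OF adm] by (simp add: is_over_extremal_def)
  have "U_plus \<kappa> F \<Omega> x = G x" for x
  proof -
    let ?L = "Lambda \<kappa> F \<Omega> x" and ?f = "inf_Psi \<kappa> F \<Omega> x"
    have le: "?f v \<le> val G x" if "v \<in> ?L" for v
      using max[OF Lambda_imp_admissible_inf_Psi[OF assms(4,1) that]] .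
    have mem: "grad G x \<in> ?L" and "val G x \<le> ?f (grad G x)"
      using admissible_imp_Lambda[OF assms(4,1) adm[OF MLE]] by auto
    with le have eq: "?f (grad G x) = val G x"
      by (simp add: antisym)
    have "u_plus \<kappa> F \<Omega> x = val G x"
      unfolding u_plus_def
    proof (rule Greatest_equality)
      show "val G x \<in> ?f ` ?L"
        using mem eq by (metis imageI)
    qed (use le in auto)
    moreover have "Du_plus \<kappa> F \<Omega> x = grad G x"
      unfolding Du_plus_def arg_max_on_def arg_max_def
    proof (rule some_equality)
      show "is_arg_max ?f (\<lambda>v. v \<in> ?L) (grad G x)"
        using mem eq le by (simp add: is_arg_max_linorder)
      fix v assume "is_arg_max ?f (\<lambda>v. v \<in> ?L) v"
      then have "v \<in> ?L" "?f v = val G x"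
        using mem eq le by (auto simp: is_arg_max_linorder intro!: antisym)
      then show "v = grad G x"
        using slope Lambda_imp_admissible_inf_Psi[OF assms(4,1)] by metis
    qed
    ultimately show ?thesis
      by (simp add: U_plus_def val_def grad_def)
  qed
  then have "U_plus \<kappa> F \<Omega> = G" ..
  moreover have "H = G" if H: "is_over_extremal F \<Omega> UNIV H" for H
  proof
    fix x
    have "is_MLE F \<Omega> UNIV H"
      using H by (simp add: is_over_extremal_def)
    moreover have "val H x = val G x"
      using H extremal by (auto simp: is_over_extremal_def intro: antisym)
    ultimately show "H x = G x"
      using slope[of x "grad H x"] adm[of H x] by (simp add: prod_eq_iff val_def grad_def)
  qed
  ultimately show ?thesis
    using extremal by blast
qed

end
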